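(* Let $(E;\tau)$ be a topological space. Then the space $\widetilde{E}$ of $s$-filters of $E$ is quasi-compact.
   Context: Let $(E;\tau)$ be a topological space. A $\tau$-filter of $E$ is a nonempty collection $\theta\subseteq\tau$ of open sets such that (i) $\emptyset\notin\theta$; (ii) $A,B\in\theta$ implies $A\cap B\in\theta$; (iii) $A\in\theta$ and $A\subseteq B\in\tau$ imply $B\in\theta$. It is a saturated filter ($s$-filter) if moreover (iv) for $A,B\in\tau$ with $A\cup B\in\theta$, one has $A\in\theta$ or $B\in\theta$. $\widetilde{E}$ denotes the set of all $s$-filters of $E$, with the canonical topology having as base the sets $\widetilde{A}=\{\theta\in\widetilde{E}\mid A\in\theta\}$, $A\in\tau$. Quasi-compact means that every open cover has a finite subcover (no separation axiom is required). *)

theory Defs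
  imports "HOL-Analysis.Abstract_Topology"
begin

definition tau_filter :: "'a topology \<Rightarrow> 'a set set \<Rightarrow> bool" where
  "tau_filter X \<theta> \<longleftrightarrow>
     \<theta> \<noteq> {} \<and> (\<forall>A\<in>\<theta>. openin X A) \<and>
     {} \<notin> \<theta> \<and>
     (\<forall>A B. A \<in> \<theta> \<and> B \<in> \<theta> \<longrightarrow> A \<inter> B \<in> \<theta>) \<and>
     (\<forall>A B. A \<in> \<theta> \<and> A \<subseteq> B \<and> openin X B \<longrightarrow> B \<in> \<theta>)"

definition s_filter :: "'a topology \<Rightarrow> 'a set set \<Rightarrow> bool" where
  "s_filter X \<theta> \<longleftrightarrow>
     tau_filter X \<theta> \<and>
     (\<forall>A B. openin X A \<and> openin X B \<and> A \<union> B \<in> \<theta> \<longrightarrow> A \<in> \<theta> \<or> B \<in> \<theta>)"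

definition basic_s_filters :: "'a topology \<Rightarrow> 'a set \<Rightarrow> 'a set set set" where
  "basic_s_filters X A = {\<theta>. s_filter X \<theta> \<and> A \<in> \<theta>}"

(* Open sets are the arbitrary unions of basic sets. The function topology is only meaningful
   on predicates satisfying istopology; openin_s_filter_space discharges that obligation. *)
definition s_filter_space :: "'a topology \<Rightarrow> 'a set set topology" where
  "s_filter_space X =
     topology (arbitrary union_of (\<lambda>U. \<exists>A. openin X A \<and> U = basic_s_filters X A))"

lemma basic_s_filters_Int:
  assumes "openin X A" "openin X B"
  shows "basic_s_filters X A \<inter> basic_s_filters X B = basic_s_filters X (A \<inter> B)"
proof -
  have "A \<inter> B \<in> \<theta> \<longleftrightarrow> A \<in> \<theta> \<and> B \<in> \<theta>" if "s_filter X \<theta>" for \<theta>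
  proof -
    have int: "\<forall>A B. A \<in> \<theta> \<and> B \<in> \<theta> \<longrightarrow> A \<inter> B \<in> \<theta>"
      using that unfolding s_filter_def tau_filter_def by (elim conjE)
    have up: "\<forall>A B. A \<in> \<theta> \<and> A \<subseteq> B \<and> openin X B \<longrightarrow> B \<in> \<theta>"
      using that unfolding s_filter_def tau_filter_def by (elim conjE)
    show ?thesis
    proof
      assume "A \<inter> B \<in> \<theta>"
      then show "A \<in> \<theta> \<and> B \<in> \<theta>"
        using up[THEN spec, of "A \<inter> B"] assms by (meson Int_lower1 Int_lower2)
    next
      assume "A \<in> \<theta> \<and> B \<in> \<theta>"
      then show "A \<inter> B \<in> \<theta>"
        by (rule int[rule_format])
    qed
  qed
  then show ?thesis
    unfolding basic_s_filters_def by blast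
qed

lemma openin_s_filter_space:
  "openin (s_filter_space X) =
     arbitrary union_of (\<lambda>U. \<exists>A. openin X A \<and> U = basic_s_filters X A)"
  unfolding s_filter_space_def
proof (rule topology_inverse', rule istopology_base)
  fix S T
  assume "\<exists>A. openin X A \<and> S = basic_s_filters X A" "\<exists>A. openin X A \<and> T = basic_s_filters X A"
  then show "\<exists>A. openin X A \<and> S \<inter> T = basic_s_filters X A"
    by (metis basic_s_filters_Int openin_Int)
qed

lemma topspace_s_filter_space: "topspace (s_filter_space X) = {\<theta>. s_filter X \<theta>}"
proof
  show "topspace (s_filter_space X) \<subseteq> {\<theta>. s_filter X \<theta>}"
  proof
    fix \<theta> assume "\<theta> \<in> topspace (s_filter_space X)"
    then obtain U where "openin (s_filter_space X) U" "\<theta> \<in> U"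
      unfolding topspace_def by blast
    then obtain A where "\<theta> \<in> basic_s_filters X A"
      unfolding openin_s_filter_space union_of_def by blast
    then show "\<theta> \<in> {\<theta>. s_filter X \<theta>}"
      unfolding basic_s_filters_def by blast
  qed
  have "topspace X \<in> \<theta>" if "s_filter X \<theta>" for \<theta>
  proof -
    have up: "\<forall>A B. A \<in> \<theta> \<and> A \<subseteq> B \<and> openin X B \<longrightarrow> B \<in> \<theta>"
      using that unfolding s_filter_def tau_filter_def by (elim conjE)
    have "\<theta> \<noteq> {} \<and> (\<forall>A\<in>\<theta>. openin X A)"
      using that unfolding s_filter_def tau_filter_def by (elim conjE) (rule conjI)
    then obtain A where "A \<in> \<theta>" "openin X A"
      by auto
    moreover from this have "A \<subseteq> topspace X"
      by (simp add: openin_subset)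
    ultimately show ?thesis
      using up[rule_format, of A "topspace X"] openin_topspace[of X] by simp
  qed
  then have "basic_s_filters X (topspace X) = {\<theta>. s_filter X \<theta>}"
    unfolding basic_s_filters_def by blast
  moreover have "openin (s_filter_space X) (basic_s_filters X (topspace X))"
    unfolding openin_s_filter_space
    by (rule arbitrary_union_of_inc, rule exI[of _ "topspace X"]) simp
  ultimately show "{\<theta>. s_filter X \<theta>} \<subseteq> topspace (s_filter_space X)"
    by (metis openin_subset)
qed

end

theory Submission imports Defs begin

text \<open>
  Call a family of open sets small if no finite subfamily covers the space. By Zorn's lemma a small
  family extends to a maximal one, and the open sets outside a maximal small family form an
  s-filter, as in the proof of Alexander's subbase theorem. So if every s-filter contains a member
  of a given family of open sets, then finitely many members cover the space, and by saturation
  every s-filter contains one of these finitely many.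
\<close>

lemma s_filter_topspace:
  assumes "s_filter X \<theta>"
  shows "topspace X \<in> \<theta>"
proof -
  have "\<theta> \<noteq> {} \<and> (\<forall>A\<in>\<theta>. openin X A)"
    using assms unfolding s_filter_def tau_filter_def by (elim conjE) (rule conjI)
  then obtain A where A: "A \<in> \<theta>" "A \<subseteq> topspace X"
    using openin_subset by blast
  have "\<forall>A B. A \<in> \<theta> \<and> A \<subseteq> B \<and> openin X B \<longrightarrow> B \<in> \<theta>"
    using assms unfolding s_filter_def tau_filter_def by (elim conjE)
  then show ?thesis
    using A openin_topspace by metis
qed

text \<open>Saturation splits off one set at a time; the induction bottoms out because the empty
  union is \<open>{}\<close>, which lies in no filter.\<close>

lemma s_filter_finite_Union:
  assumes \<theta>: "s_filter X \<theta>"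
    and "finite \<F>" "\<And>A. A \<in> \<F> \<Longrightarrow> openin X A" "\<Union>\<F> \<in> \<theta>"
  shows "\<exists>A\<in>\<F>. A \<in> \<theta>"
  using assms(2-)
proof (induction \<F> rule: finite_induct)
  case empty
  then show ?case
    using \<theta> by (simp add: s_filter_def tau_filter_def)
next
  case (insert A \<F>)
  have "A \<union> \<Union>\<F> \<in> \<theta>" "openin X A" "openin X (\<Union>\<F>)"
    using insert.prems by auto
  then have "A \<in> \<theta> \<or> \<Union>\<F> \<in> \<theta>"
    using \<theta> unfolding s_filter_def by blast
  then show ?case
    using insert by auto
qed

text \<open>The empty subfamily counts as finite, so no family is small when
  \<open>topspace X\<close> is empty; in that case there are no s-filters either.\<close>

definition small_family :: "'a topology \<Rightarrow> 'a set set \<Rightarrow> bool" where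
  "small_family X \<A> \<longleftrightarrow>
     (\<forall>A\<in>\<A>. openin X A) \<and> (\<forall>\<F>. finite \<F> \<and> \<F> \<subseteq> \<A> \<longrightarrow> \<not> topspace X \<subseteq> \<Union>\<F>)"

text \<open>Smallness passes to the union of a nonempty chain, since it only concerns finite
  subfamilies and each of these already lies in one member of the chain.\<close>

lemma maximal_small_family_exists:
  assumes "small_family X \<A>"
  obtains \<M> where "\<A> \<subseteq> \<M>" "small_family X \<M>"
    "\<And>\<N>. small_family X \<N> \<Longrightarrow> \<M> \<subseteq> \<N> \<Longrightarrow> \<N> = \<M>"
proof -
  let ?P = "{\<N>. \<A> \<subseteq> \<N> \<and> small_family X \<N>}"
  have "\<exists>\<M>\<in>?P. \<forall>\<N>\<in>?P. \<M> \<subseteq> \<N> \<longrightarrow> \<N> = \<M>"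
  proof (rule subset_Zorn_nonempty)
    show "?P \<noteq> {}"
      using assms by blast
  next
    fix \<C> assume "\<C> \<noteq> {}" and chain: "subset.chain ?P \<C>"
    then have C: "\<And>\<N>. \<N> \<in> \<C> \<Longrightarrow> \<A> \<subseteq> \<N> \<and> small_family X \<N>"
      by (auto simp: subset.chain_def)
    have "\<not> topspace X \<subseteq> \<Union>\<F>" if F: "finite \<F>" "\<F> \<subseteq> \<Union>\<C>" for \<F>
    proof -
      obtain \<N> where "\<N> \<in> \<C>" "\<F> \<subseteq> \<N>"
        using finite_subset_Union_chain[OF F \<open>\<C> \<noteq> {}\<close> chain] by blast
      then show ?thesis
        using C F(1) unfolding small_family_def by blast
    qed
    then have "small_family X (\<Union>\<C>)"
      using C unfolding small_family_def by blast
    then show "\<Union>\<C> \<in> ?P"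
      using C \<open>\<C> \<noteq> {}\<close> by blast
  qed
  then show thesis
    using that by (smt (verit) mem_Collect_eq order_trans)
qed

lemma s_filter_Diff_maximal_small_family:
  assumes small: "small_family X \<M>"
    and max: "\<And>\<N>. small_family X \<N> \<Longrightarrow> \<M> \<subseteq> \<N> \<Longrightarrow> \<N> = \<M>"
  shows "s_filter X {A. openin X A \<and> A \<notin> \<M>}"
proof -
  \<comment> \<open>The key to all filter axioms: lying outside \<M> means completing some finite
    part of \<M> to a cover. Maximality, applied to \<open>insert A \<M>\<close>, gives one
    direction, smallness of \<M> the other.\<close>
  have outside: "A \<notin> \<M> \<longleftrightarrow> (\<exists>\<F>. finite \<F> \<and> \<F> \<subseteq> \<M> \<and> topspace X \<subseteq> A \<union> \<Union>\<F>)"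
    if "openin X A" for A
  proof
    assume "A \<notin> \<M>"
    then have "\<not> small_family X (insert A \<M>)"
      using max by blast
    moreover have "\<forall>B\<in>insert A \<M>. openin X B"
      using small that by (simp add: small_family_def)
    ultimately obtain \<F> where "finite \<F>" "\<F> \<subseteq> insert A \<M>" "topspace X \<subseteq> \<Union>\<F>"
      unfolding small_family_def by meson
    \<comment> \<open>The cover may use \<open>A\<close> itself; what is left after removing it
      comes from \<M>.\<close>
    then have "finite (\<F> - {A})" "\<F> - {A} \<subseteq> \<M>" "topspace X \<subseteq> A \<union> \<Union>(\<F> - {A})"
      by auto
    then show "\<exists>\<F>. finite \<F> \<and> \<F> \<subseteq> \<M> \<and> topspace X \<subseteq> A \<union> \<Union>\<F>"
      by blast
  next
    assume "\<exists>\<F>. finite \<F> \<and> \<F> \<subseteq> \<M> \<and> topspace X \<subseteq> A \<union> \<Union>\<F>"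
    then obtain \<F> where F: "finite \<F>" "\<F> \<subseteq> \<M>" "topspace X \<subseteq> \<Union>(insert A \<F>)"
      by auto
    show "A \<notin> \<M>"
    proof
      assume "A \<in> \<M>"
      then have "finite (insert A \<F>)" "insert A \<F> \<subseteq> \<M>"
        using F by auto
      then show False
        using F(3) small unfolding small_family_def by blast
    qed
  qed
  \<comment> \<open>The empty subfamily is the witness here, as \<open>topspace X\<close> covers by
    itself.\<close>
  have top: "topspace X \<notin> \<M>"
    using outside[OF openin_topspace] by (metis empty_subsetI finite.emptyI sup_ge1)
  have empty: "{} \<in> \<M>"
  proof -
    have "\<not> (\<exists>\<F>. finite \<F> \<and> \<F> \<subseteq> \<M> \<and> topspace X \<subseteq> {} \<union> \<Union>\<F>)"
      using small unfolding small_family_def by auto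
    then show ?thesis
      using outside[OF openin_empty] by blast
  qed
  have inter: "A \<inter> B \<notin> \<M>"
    if AB: "openin X A" "openin X B" "A \<notin> \<M>" "B \<notin> \<M>" for A B
  proof -
    obtain \<F> \<G> where "finite \<F>" "\<F> \<subseteq> \<M>" "topspace X \<subseteq> A \<union> \<Union>\<F>"
      and "finite \<G>" "\<G> \<subseteq> \<M>" "topspace X \<subseteq> B \<union> \<Union>\<G>"
      using AB outside by meson
    \<comment> \<open>A point missed by both finite subfamilies must lie in \<open>A\<close> and in
      \<open>B\<close>.\<close>
    then have "finite (\<F> \<union> \<G>)" "\<F> \<union> \<G> \<subseteq> \<M>" "topspace X \<subseteq> (A \<inter> B) \<union> \<Union>(\<F> \<union> \<G>)"
      by auto
    then show ?thesis
      using outside[OF openin_Int[OF AB(1,2)]] by blast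
  qed
  have up: "B \<notin> \<M>" if "openin X A" "A \<notin> \<M>" "A \<subseteq> B" "openin X B" for A B
    using that outside by (meson Un_mono order_refl order_trans)
  \<comment> \<open>If both sets were in \<M>, they could join the finite part of \<M> that
    completes their union to a cover, contradicting smallness.\<close>
  have prime: "A \<notin> \<M> \<or> B \<notin> \<M>" if AB: "openin X A" "openin X B" "A \<union> B \<notin> \<M>" for A B
  proof (rule ccontr)
    assume mem: "\<not> (A \<notin> \<M> \<or> B \<notin> \<M>)"
    obtain \<F> where "finite \<F>" "\<F> \<subseteq> \<M>" "topspace X \<subseteq> (A \<union> B) \<union> \<Union>\<F>"
      using outside[OF openin_Un[OF AB(1,2)]] AB(3) by blast
    then have "finite (insert A (insert B \<F>))" "insert A (insert B \<F>) \<subseteq> \<M>"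
      "topspace X \<subseteq> \<Union>(insert A (insert B \<F>))"
      using mem by auto
    then show False
      using small unfolding small_family_def by blast
  qed
  let ?\<theta> = "{A. openin X A \<and> A \<notin> \<M>}"
  have "tau_filter X ?\<theta>"
    unfolding tau_filter_def
  proof (intro conjI allI impI)
    show "?\<theta> \<noteq> {}"
      using top openin_topspace by blast
  qed (use empty inter up in auto)
  moreover have "\<forall>A B. openin X A \<and> openin X B \<and> A \<union> B \<in> ?\<theta> \<longrightarrow> A \<in> ?\<theta> \<or> B \<in> ?\<theta>"
    using prime unfolding mem_Collect_eq by meson
  ultimately show ?thesis
    unfolding s_filter_def by (rule conjI)
qed

text \<open>Used in contrapositive form: a family of open sets that meets every s-filter has a
  finite subfamily covering the space.\<close>

lemma s_filter_avoiding_small_family: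
  assumes "small_family X \<A>"
  obtains \<theta> where "s_filter X \<theta>" "\<theta> \<inter> \<A> = {}"
proof -
  obtain \<M> where "\<A> \<subseteq> \<M>" "small_family X \<M>"
    "\<And>\<N>. small_family X \<N> \<Longrightarrow> \<M> \<subseteq> \<N> \<Longrightarrow> \<N> = \<M>"
    using maximal_small_family_exists[OF assms] by metis
  then show thesis
    using that[OF s_filter_Diff_maximal_small_family[of X \<M>]] by blast
qed

theorem proposition2p10:
  fixes X :: "'a topology"
  shows "compact_space (s_filter_space X)"
  unfolding compact_space_def compactin_def topspace_s_filter_space
proof (intro conjI allI impI order_refl)
  fix \<U>
  assume "Ball \<U> (openin (s_filter_space X)) \<and> {\<theta>. s_filter X \<theta>} \<subseteq> \<Union>\<U>"
  then have op: "\<And>U. U \<in> \<U> \<Longrightarrow> openin (s_filter_space X) U"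
    and cover: "\<And>\<theta>. s_filter X \<theta> \<Longrightarrow> \<theta> \<in> \<Union>\<U>"
    by auto
  \<comment> \<open>This moves the cover of the s-filter space down to \<open>X\<close>: \<A>
    indexes the basic sets that refine \<U>.\<close>
  define \<A> where "\<A> = {A. openin X A \<and> (\<exists>U\<in>\<U>. basic_s_filters X A \<subseteq> U)}"
  have "\<theta> \<inter> \<A> \<noteq> {}" if \<theta>: "s_filter X \<theta>" for \<theta>
  proof -
    obtain U where U: "U \<in> \<U>" "\<theta> \<in> U"
      using cover[OF \<theta>] by blast
    then obtain A where "openin X A" "\<theta> \<in> basic_s_filters X A" "basic_s_filters X A \<subseteq> U"
      using op[OF U(1)] unfolding openin_s_filter_space union_of_def by blast
    then show ?thesis
      using U(1) unfolding \<A>_def basic_s_filters_def by blast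
  qed
  then have "\<not> small_family X \<A>"
    using s_filter_avoiding_small_family by metis
  then obtain \<F> where F: "finite \<F>" "\<F> \<subseteq> \<A>" "topspace X \<subseteq> \<Union>\<F>"
    unfolding small_family_def \<A>_def by blast
  have F_open: "\<And>A. A \<in> \<F> \<Longrightarrow> openin X A"
    and "\<forall>A\<in>\<F>. \<exists>U\<in>\<U>. basic_s_filters X A \<subseteq> U"
    using F(2) unfolding \<A>_def by auto
  \<comment> \<open>Choosing one member of \<U> above each basic set turns the finite subfamily of
    \<A> into a finite subfamily of \<U>.\<close>
  then obtain u where u: "\<And>A. A \<in> \<F> \<Longrightarrow> u A \<in> \<U> \<and> basic_s_filters X A \<subseteq> u A"
    by metis
  have "\<theta> \<in> \<Union>(u ` \<F>)" if \<theta>: "s_filter X \<theta>" for \<theta>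
  proof -
    \<comment> \<open>Equality puts the union into \<theta>, which contains
      \<open>topspace X\<close>, so saturation yields a member of \<F> in \<theta>.\<close>
    have "\<Union>\<F> = topspace X"
      using F(3) F_open openin_subset by blast
    then obtain A where "A \<in> \<F>" "A \<in> \<theta>"
      using s_filter_finite_Union[OF \<theta> F(1) F_open] s_filter_topspace[OF \<theta>] by auto
    then show ?thesis
      using u \<theta> unfolding basic_s_filters_def by blast
  qed
  then show "\<exists>\<V>. finite \<V> \<and> \<V> \<subseteq> \<U> \<and> {\<theta>. s_filter X \<theta>} \<subseteq> \<Union>\<V>"
    using F(1) u by (intro exI[of _ "u ` \<F>"]) auto
qed

end
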